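(* Let $p\in\mathbb N_0$ and suppose that $A\in\mathcal P^p(\mathcal T)^{2\times2}\cap\boldsymbol L^2_{\rm sym}(\Omega)$. Then $\Pi_F:=(\Pi^p,\Pi^{\mathrm{div}\mathbf{Div}}):V\to V_{hp}$, $\Pi_F(v,\boldsymbol Q)=(\Pi^pv,\Pi^{\mathrm{div}\mathbf{Div}}\boldsymbol Q)$, is a Fortin operator for $b$ and the spaces $U_h$, $V_{hp}$, i.e., there is a constant $C_F>0$ with $$\|\Pi_F\boldsymbol v\|_V\le C_F\|\boldsymbol v\|_V\quad\forall\,\boldsymbol v\in V\qquad\text{and}\qquad b(\boldsymbol u_h,\Pi_F\boldsymbol v)=b(\boldsymbol u_h,\boldsymbol v)\quad\forall\,\boldsymbol u_h\in U_h,\ \boldsymbol v\in V.$$ Here $C_F$ depends only on $\Omega$, $A$ and the shape-regularity of $\mathcal T$.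
   Context: Setting. Let $d=2$, $\Omega\subset\mathbb R^2$ a bounded convex polygonal domain, $A:\Omega\to\mathbb R^{2\times2}_{\rm sym}$ measurable with $0<\operatorname{ess\,inf}_{\Omega}\lambda_{\min}(A(x))\le\operatorname{ess\,sup}_\Omega\lambda_{\max}(A(x))<\infty$ (for $d=2$ this implies the Cordes condition: $\|A\|_F^2/(\mathrm{tr}A)^2\le 1/(1+\varepsilon)$ a.e. for some $0<\varepsilon\le1$). $\mathcal T$ is a shape-regular (conforming) triangulation of $\Omega$ into triangles; $\mathcal E_T$ is the set of edges of $T$, $\boldsymbol n_T$ the unit normal on $\partial T$. Notation. $(\cdot,\cdot)_\omega$, $\|\cdot\|_\omega$ are the $L^2(\omega)$ inner product and norm (also for matrix-valued functions, with the Frobenius product $:$); the index is dropped for $\omega=\Omega$. $\boldsymbol L^2_{\rm sym}(\omega)$ is the space of symmetric matrix functions with $L^2(\omega)$ entries. $\|v\|_{H^k(\omega)}^2=\|v\|_\omega^2+\|D^kv\|_\omega^2$. $X:=H^2(\Omega)\cap H^1_0(\Omega)$. $\mathrm{div}\,\mathbf{Div}$ is the iterated divergence (row-wise divergence followed by divergence). $\boldsymbol H(\mathrm{div}\,\mathbf{Div};\omega)$ is the completion of smooth (up to the boundary) symmetric matrix functions on $\overline\omega$ in the norm $(\|\cdot\|_\omega^2+\|\mathrm{div}\,\mathbf{Div}(\cdot)\|_\omega^2)^{1/2}$. $Q:=\boldsymbol H(\mathrm{div}\,\mathbf{Div};\mathcal T):=\prod_{T\in\mathcal T}\boldsymbol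 H(\mathrm{div}\,\mathbf{Div};T)$ with the product norm $\|\cdot\|_Q$; $(u,\mathrm{div}\,\mathbf{Div}\,\boldsymbol Q)_{\mathcal T}:=\sum_T(u,\mathrm{div}\,\mathbf{Div}\,\boldsymbol Q)_T$. Traces. For $u\in H^2(T)$: $\langle\mathrm{tr}^2_Tu,\boldsymbol Q\rangle_{\partial T}:=(\mathrm{div}\,\mathbf{Div}\,\boldsymbol Q,u)_T-(\boldsymbol Q,D^2u)_T$ for $\boldsymbol Q\in\boldsymbol H(\mathrm{div}\,\mathbf{Div};T)$. For $u\in H^2(\Omega)$: $\langle\mathrm{tr}^2_{\mathcal T}u,\boldsymbol Q\rangle_{\mathcal S}:=\sum_T\langle\mathrm{tr}^2_Tu,\boldsymbol Q\rangle_{\partial T}$ for $\boldsymbol Q\in Q$. $\widehat U:=\mathrm{tr}^2_{\mathcal T}(X)$ with norm $\|\widehat{\boldsymbol u}\|_{3/2,1/2,\mathcal S}:=\inf\{\|u\|_{H^2(\Omega)}:\mathrm{tr}^2_{\mathcal T}u=\widehat{\boldsymbol u}\}$; for $\widehat{\boldsymbol u}=\mathrm{tr}^2_{\mathcal T}u$ write $\widehat{\boldsymbol u}|_{\partial T}=\mathrm{tr}^2_T(u|_T)$. Spaces and form. $U:=L^2(\Omega)\times\boldsymbol L^2_{\rm sym}(\Omega)\times\widehat U$ and $V:=L^2(\Omega)\times Q$ with $\|(v,\boldsymbol Q)\|_V^2:=\|v\|^2+\|\boldsymbol Q\|_Q^2$. For $\boldsymbol u=(u,\boldsymbol M,\widehat{\boldsymbol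 u})\in U$, $\boldsymbol v=(v,\boldsymbol Q)\in V$: $b(\boldsymbol u,\boldsymbol v):=-(u,\mathrm{div}\,\mathbf{Div}\,\boldsymbol Q)_{\mathcal T}+(\boldsymbol M,Av+\boldsymbol Q)+\langle\widehat{\boldsymbol u},\boldsymbol Q\rangle_{\mathcal S}$. Discrete spaces. $\mathcal P^p(T)$ (resp. $\mathcal P^p(E)$): polynomials of degree $\le p$ on $T$ (resp. on the edge $E$); $\mathcal P^p(\mathcal T):=\{v\in L^2(\Omega):v|_T\in\mathcal P^p(T)\ \forall T\in\mathcal T\}$; $\mathcal P^p(\mathcal E_T):=\{v\in L^2(\partial T):v|_E\in\mathcal P^p(E)\ \forall E\in\mathcal E_T\}$. $U_T:=\{v\in H^2(T):\Delta^2v+v=0,\ v|_{\partial T}\in\mathcal P^3(\mathcal E_T),\ \boldsymbol n_T\cdot\nabla v|_{\partial T}\in\mathcal P^1(\mathcal E_T)\}$, $\widehat U_T:=\mathrm{tr}^2_T(U_T)$, $\widehat U_h:=\{\widehat{\boldsymbol v}\in\widehat U:\widehat{\boldsymbol v}|_{\partial T}\in\widehat U_T\ \forall T\in\mathcal T\}$. $U_h:=\mathcal P^0(\mathcal T)\times(\mathcal P^0(\mathcal T)^{2\times2}\cap\boldsymbol L^2_{\rm sym}(\Omega))\times\widehat U_h$; $Q_h:=\mathcal P^4(\mathcal T)^{2\times2}\cap\boldsymbol L^2_{\rm sym}(\Omega)$; $V_{hp}:=\mathcal P^p(\mathcal T)\times Q_h$. Operators. $\Pi^p:L^2(\Omega)\to\mathcal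 P^p(\mathcal T)$ is the $L^2(\Omega)$-orthogonal projection. $\Pi^{\mathrm{div}\mathbf{Div}}:Q\to Q_h$ is a fixed linear operator (its existence is a known result) such that for all $\boldsymbol Q\in Q$: $\langle\widehat{\boldsymbol u},\Pi^{\mathrm{div}\mathbf{Div}}\boldsymbol Q\rangle_{\mathcal S}=\langle\widehat{\boldsymbol u},\boldsymbol Q\rangle_{\mathcal S}$ for all $\widehat{\boldsymbol u}\in\widehat U_h$; $(\boldsymbol M,\Pi^{\mathrm{div}\mathbf{Div}}\boldsymbol Q)=(\boldsymbol M,\boldsymbol Q)$ for all $\boldsymbol M\in\mathcal P^0(\mathcal T)^{2\times2}\cap\boldsymbol L^2_{\rm sym}(\Omega)$; $(u,\mathrm{div}\,\mathbf{Div}\,\Pi^{\mathrm{div}\mathbf{Div}}\boldsymbol Q)_{\mathcal T}=(u,\mathrm{div}\,\mathbf{Div}\,\boldsymbol Q)_{\mathcal T}$ for all $u\in\mathcal P^2(\mathcal T)$; and $\|\Pi^{\mathrm{div}\mathbf{Div}}\boldsymbol Q\|_Q\le C\|\boldsymbol Q\|_Q$ with $C$ depending only on $\Omega$ and the shape-regularity of $\mathcal T$. *)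

theory Defs
  imports "HOL-Probability.Essential_Supremum"
begin

text \<open>
  Members of \<open>L\<^sup>2\<close> spaces are represented by functions; equality of members is equality almost
  everywhere. A scalar, vector or matrix valued function may be defined on all of the ambient
  space, but only its values on the set in question enter. The norm and inner product of
  \<^typ>\<open>real^2^2\<close> are the Frobenius ones.
\<close>

definition L2 :: "'a::euclidean_space set \<Rightarrow> ('a \<Rightarrow> 'b::euclidean_space) set" where
  "L2 \<omega> = {f \<in> borel_measurable (lebesgue_on \<omega>). integrable (lebesgue_on \<omega>) (\<lambda>x. (norm (f x))\<^sup>2)}"

definition L2_inner ::
  "'a::euclidean_space set \<Rightarrow> ('a \<Rightarrow> 'b::euclidean_space) \<Rightarrow> ('a \<Rightarrow> 'b) \<Rightarrow> real" where
  "L2_inner \<omega> f g = (LINT x|lebesgue_on \<omega>. f x \<bullet> g x)"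

definition L2_norm :: "'a::euclidean_space set \<Rightarrow> ('a \<Rightarrow> 'b::euclidean_space) \<Rightarrow> real" where
  "L2_norm \<omega> f = sqrt (L2_inner \<omega> f f)"

definition L2_sym :: "(real^2) set \<Rightarrow> (real^2 \<Rightarrow> real^2^2) set" where
  "L2_sym \<omega> = {M \<in> L2 \<omega>. AE x in lebesgue_on \<omega>. transpose (M x) = M x}"

text \<open>The \<open>L\<^sup>2\<close>-orthogonal projection onto \<open>S\<close>; it is unique up to null sets.\<close>

definition L2_proj ::
  "'a::euclidean_space set \<Rightarrow> ('a \<Rightarrow> 'b::euclidean_space) set \<Rightarrow> ('a \<Rightarrow> 'b) \<Rightarrow> 'a \<Rightarrow> 'b" where
  "L2_proj \<omega> S v = (SOME w. w \<in> S \<and> (\<forall>q\<in>S. L2_inner \<omega> (\<lambda>x. v x - w x) q = 0))"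

definition partial_deriv ::
  "2 \<Rightarrow> (real^2 \<Rightarrow> 'b::real_normed_vector) \<Rightarrow> real^2 \<Rightarrow> 'b" where
  "partial_deriv i f x = frechet_derivative f (at x) (axis i 1)"

definition smooth :: "(real^2 \<Rightarrow> 'b::real_normed_vector) \<Rightarrow> bool" where
  "smooth f \<longleftrightarrow> (\<forall>is x. foldr partial_deriv is f differentiable (at x))"

definition gradient :: "(real^2 \<Rightarrow> real) \<Rightarrow> real^2 \<Rightarrow> real^2" where
  "gradient f x = (\<chi> i. partial_deriv i f x)"

definition divergence :: "(real^2 \<Rightarrow> real^2) \<Rightarrow> real^2 \<Rightarrow> real" where
  "divergence q x = (\<Sum>i\<in>UNIV. partial_deriv i (\<lambda>y. q y $ i) x)"

definition row_divergence :: "(real^2 \<Rightarrow> real^2^2) \<Rightarrow> real^2 \<Rightarrow> real^2" where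
  "row_divergence Q x = (\<chi> i. divergence (\<lambda>y. Q y $ i) x)"

definition laplacian :: "(real^2 \<Rightarrow> real) \<Rightarrow> real^2 \<Rightarrow> real" where
  "laplacian f = divergence (gradient f)"

text \<open>
  The set \<open>\<omega>\<close> below is either a domain or a closed triangle. In the latter case the spaces are those
  of its interior: test functions are supported in the interior, and the boundary is a null set.
\<close>

definition test_function :: "(real^2) set \<Rightarrow> (real^2 \<Rightarrow> real) \<Rightarrow> bool" where
  "test_function \<omega> \<phi> \<longleftrightarrow> smooth \<phi> \<and> compact (closure {x. \<phi> x \<noteq> 0}) \<and>
     closure {x. \<phi> x \<noteq> 0} \<subseteq> interior \<omega>"

definition has_weak_gradient ::
  "(real^2) set \<Rightarrow> (real^2 \<Rightarrow> real) \<Rightarrow> (real^2 \<Rightarrow> real^2) \<Rightarrow> bool" where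
  "has_weak_gradient \<omega> v g \<longleftrightarrow> g \<in> L2 \<omega> \<and>
     (\<forall>\<phi> i. test_function \<omega> \<phi> \<longrightarrow>
        L2_inner \<omega> v (partial_deriv i \<phi>) = - L2_inner \<omega> (\<lambda>x. g x $ i) \<phi>)"

definition has_weak_hessian ::
  "(real^2) set \<Rightarrow> (real^2 \<Rightarrow> real) \<Rightarrow> (real^2 \<Rightarrow> real^2^2) \<Rightarrow> bool" where
  "has_weak_hessian \<omega> v H \<longleftrightarrow> H \<in> L2 \<omega> \<and>
     (\<forall>\<phi> i j. test_function \<omega> \<phi> \<longrightarrow>
        L2_inner \<omega> v (partial_deriv i (partial_deriv j \<phi>)) = L2_inner \<omega> (\<lambda>x. H x $ i $ j) \<phi>)"

definition weak_gradient :: "(real^2) set \<Rightarrow> (real^2 \<Rightarrow> real) \<Rightarrow> real^2 \<Rightarrow> real^2" where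
  "weak_gradient \<omega> v = (SOME g. has_weak_gradient \<omega> v g)"

definition weak_hessian :: "(real^2) set \<Rightarrow> (real^2 \<Rightarrow> real) \<Rightarrow> real^2 \<Rightarrow> real^2^2" where
  "weak_hessian \<omega> v = (SOME H. has_weak_hessian \<omega> v H)"

definition H1 :: "(real^2) set \<Rightarrow> (real^2 \<Rightarrow> real) set" where
  "H1 \<omega> = {v \<in> L2 \<omega>. \<exists>g. has_weak_gradient \<omega> v g}"

definition H2 :: "(real^2) set \<Rightarrow> (real^2 \<Rightarrow> real) set" where
  "H2 \<omega> = {v \<in> H1 \<omega>. \<exists>H. has_weak_hessian \<omega> v H}"

text \<open>Convergence in the \<open>H\<^sup>1\<close>-norm of a sequence of smooth functions.\<close>

definition smooth_tendsto_H1 ::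
  "(real^2) set \<Rightarrow> (nat \<Rightarrow> real^2 \<Rightarrow> real) \<Rightarrow> (real^2 \<Rightarrow> real) \<Rightarrow> bool" where
  "smooth_tendsto_H1 \<omega> s v \<longleftrightarrow>
     (\<lambda>n. L2_norm \<omega> (\<lambda>x. s n x - v x)) \<longlonglongrightarrow> 0 \<and>
     (\<lambda>n. L2_norm \<omega> (\<lambda>x. gradient (s n) x - weak_gradient \<omega> v x)) \<longlonglongrightarrow> 0"

definition H1_0 :: "(real^2) set \<Rightarrow> (real^2 \<Rightarrow> real) set" where
  "H1_0 \<omega> = {v \<in> H1 \<omega>. \<exists>s. (\<forall>n. test_function \<omega> (s n)) \<and> smooth_tendsto_H1 \<omega> s v}"

definition X_space :: "(real^2) set \<Rightarrow> (real^2 \<Rightarrow> real) set" where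
  "X_space \<Omega> = H2 \<Omega> \<inter> H1_0 \<Omega>"

text \<open>
  The completion of the smooth symmetric matrix functions in the graph norm of \<open>div Div\<close>, realised
  inside \<open>L\<^sup>2\<close>: a Cauchy sequence in the graph norm has an \<open>L\<^sup>2\<close>-limit \<open>Q\<close>, and the limit \<open>g\<close> of its
  iterated divergences is determined by \<open>Q\<close> since \<open>div Div\<close> is closable.
\<close>

definition has_divDiv ::
  "(real^2) set \<Rightarrow> (real^2 \<Rightarrow> real^2^2) \<Rightarrow> (real^2 \<Rightarrow> real) \<Rightarrow> bool" where
  "has_divDiv \<omega> Q g \<longleftrightarrow> Q \<in> L2_sym \<omega> \<and> g \<in> L2 \<omega> \<and>
     (\<exists>s. (\<forall>n. smooth (s n) \<and> (\<forall>x. transpose (s n x) = s n x)) \<and>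
          (\<lambda>n. L2_norm \<omega> (\<lambda>x. s n x - Q x)) \<longlonglongrightarrow> 0 \<and>
          (\<lambda>n. L2_norm \<omega> (\<lambda>x. divergence (row_divergence (s n)) x - g x)) \<longlonglongrightarrow> 0)"

definition H_divDiv :: "(real^2) set \<Rightarrow> (real^2 \<Rightarrow> real^2^2) set" where
  "H_divDiv \<omega> = {Q. \<exists>g. has_divDiv \<omega> Q g}"

definition divDiv :: "(real^2) set \<Rightarrow> (real^2 \<Rightarrow> real^2^2) \<Rightarrow> real^2 \<Rightarrow> real" where
  "divDiv \<omega> Q = (SOME g. has_divDiv \<omega> Q g)"

definition convex_polygonal_domain :: "(real^2) set \<Rightarrow> bool" where
  "convex_polygonal_domain \<Omega> \<longleftrightarrow>
     open \<Omega> \<and> \<Omega> \<noteq> {} \<and> bounded \<Omega> \<and> convex \<Omega> \<and> polytope (closure \<Omega>)"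

definition eigenvalues :: "real^2^2 \<Rightarrow> real set" where
  "eigenvalues M = {l. \<exists>v. v \<noteq> 0 \<and> M *v v = l *\<^sub>R v}"

definition lambda_min :: "real^2^2 \<Rightarrow> real" where
  "lambda_min M = Min (eigenvalues M)"

definition lambda_max :: "real^2^2 \<Rightarrow> real" where
  "lambda_max M = Max (eigenvalues M)"

definition essinf :: "'a measure \<Rightarrow> ('a \<Rightarrow> ereal) \<Rightarrow> ereal" where
  "essinf M f = - esssup M (\<lambda>x. - f x)"

definition elliptic_coefficient :: "(real^2) set \<Rightarrow> (real^2 \<Rightarrow> real^2^2) \<Rightarrow> bool" where
  "elliptic_coefficient \<Omega> A \<longleftrightarrow>
     A \<in> borel_measurable (lebesgue_on \<Omega>) \<and> (\<forall>x\<in>\<Omega>. transpose (A x) = A x) \<and>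
     0 < essinf (lebesgue_on \<Omega>) (\<lambda>x. ereal (lambda_min (A x))) \<and>
     essinf (lebesgue_on \<Omega>) (\<lambda>x. ereal (lambda_min (A x)))
       \<le> esssup (lebesgue_on \<Omega>) (\<lambda>x. ereal (lambda_max (A x))) \<and>
     esssup (lebesgue_on \<Omega>) (\<lambda>x. ereal (lambda_max (A x))) < \<infinity>"

text \<open>The members of a mesh are closed triangles; \<^const>\<open>triangulation\<close> includes conformity.\<close>

definition mesh_of :: "(real^2) set \<Rightarrow> (real^2) set set \<Rightarrow> bool" where
  "mesh_of \<Omega> \<T> \<longleftrightarrow> triangulation \<T> \<and> (\<forall>T\<in>\<T>. 2 simplex T) \<and> \<Union>\<T> = closure \<Omega>"

text \<open>
  Shape regularity with parameter \<open>\<kappa>\<close>: the ratio of the diameter of each triangle and the diameter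
  of its largest inscribed ball is at most \<open>\<kappa>\<close>.
\<close>

definition shape_regular :: "real \<Rightarrow> (real^2) set set \<Rightarrow> bool" where
  "shape_regular \<kappa> \<T> \<longleftrightarrow>
     (\<forall>T\<in>\<T>. \<exists>x r. 0 < r \<and> cball x r \<subseteq> T \<and> diameter T \<le> \<kappa> * (2 * r))"

definition polys :: "nat \<Rightarrow> (real^2 \<Rightarrow> real) set" where
  "polys p = {f. \<exists>c. \<forall>x. f x = (\<Sum>i\<le>p. \<Sum>j\<le>p - i. c i j * (x $ 1) ^ i * (x $ 2) ^ j)}"

definition pw_polys :: "nat \<Rightarrow> (real^2) set \<Rightarrow> (real^2) set set \<Rightarrow> (real^2 \<Rightarrow> real) set" where
  "pw_polys p \<Omega> \<T> =
     {v \<in> L2 \<Omega>. \<forall>T\<in>\<T>. \<exists>q\<in>polys p. AE x in lebesgue_on T. v x = q x}"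

definition pw_polys_sym ::
  "nat \<Rightarrow> (real^2) set \<Rightarrow> (real^2) set set \<Rightarrow> (real^2 \<Rightarrow> real^2^2) set" where
  "pw_polys_sym p \<Omega> \<T> = {M \<in> L2_sym \<Omega>. \<forall>i j. (\<lambda>x. M x $ i $ j) \<in> pw_polys p \<Omega> \<T>}"

text \<open>
  An element of the product of the local spaces is identified with one function on \<open>\<Omega>\<close>; the
  triangles overlap only in null sets.
\<close>

definition Q_space :: "(real^2) set set \<Rightarrow> (real^2 \<Rightarrow> real^2^2) set" where
  "Q_space \<T> = {Q. \<forall>T\<in>\<T>. Q \<in> H_divDiv T}"

definition Q_norm :: "(real^2) set set \<Rightarrow> (real^2 \<Rightarrow> real^2^2) \<Rightarrow> real" where
  "Q_norm \<T> Q = sqrt (\<Sum>T\<in>\<T>. (L2_norm T Q)\<^sup>2 + (L2_norm T (divDiv T Q))\<^sup>2)"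

definition broken_divDiv_inner ::
  "(real^2) set set \<Rightarrow> (real^2 \<Rightarrow> real) \<Rightarrow> (real^2 \<Rightarrow> real^2^2) \<Rightarrow> real" where
  "broken_divDiv_inner \<T> u Q = (\<Sum>T\<in>\<T>. L2_inner T u (divDiv T Q))"

text \<open>
  Traces are functionals on \<^const>\<open>H_divDiv\<close> and \<^const>\<open>Q_space\<close>. They are made extensional, so that
  equality of traces is equality as functionals.
\<close>

type_synonym trace_functional = "(real^2 \<Rightarrow> real^2^2) \<Rightarrow> real"

definition tr_loc :: "(real^2) set \<Rightarrow> (real^2 \<Rightarrow> real) \<Rightarrow> trace_functional" where
  "tr_loc T u = (\<lambda>Q\<in>H_divDiv T. L2_inner T (divDiv T Q) u - L2_inner T Q (weak_hessian T u))"

definition tr_mesh :: "(real^2) set set \<Rightarrow> (real^2 \<Rightarrow> real) \<Rightarrow> trace_functional" where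
  "tr_mesh \<T> u = (\<lambda>Q\<in>Q_space \<T>. \<Sum>T\<in>\<T>. tr_loc T u Q)"

definition Uhat :: "(real^2) set \<Rightarrow> (real^2) set set \<Rightarrow> trace_functional set" where
  "Uhat \<Omega> \<T> = tr_mesh \<T> ` X_space \<Omega>"

text \<open>The restriction of \<open>\<uu> = tr_mesh \<T> u\<close> to one triangle; it does not depend on the choice of \<open>u\<close>.\<close>

definition trace_restrict ::
  "(real^2) set \<Rightarrow> (real^2) set set \<Rightarrow> (real^2) set \<Rightarrow> trace_functional \<Rightarrow> trace_functional" where
  "trace_restrict \<Omega> \<T> T \<uu> = tr_loc T (SOME u. u \<in> X_space \<Omega> \<and> tr_mesh \<T> u = \<uu>)"

text \<open>
  \<open>\<tau>\<close> is the trace on the segment from \<open>a\<close> to \<open>b\<close> of the \<open>H\<^sup>1\<close>-function \<open>w\<close>, written in the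
  affine parameter \<open>t \<in> [0,1]\<close> of the segment. This parametrization is affine, so it preserves
  polynomials and their degrees.
\<close>

definition has_edge_trace ::
  "(real^2) set \<Rightarrow> real^2 \<Rightarrow> real^2 \<Rightarrow> (real^2 \<Rightarrow> real) \<Rightarrow> (real \<Rightarrow> real) \<Rightarrow> bool" where
  "has_edge_trace T a b w \<tau> \<longleftrightarrow> w \<in> H1 T \<and> \<tau> \<in> L2 {0..1} \<and>
     (\<exists>s. (\<forall>n. smooth (s n)) \<and> smooth_tendsto_H1 T s w \<and>
        (\<lambda>n. L2_norm {0..1} (\<lambda>t. s n (a + t *\<^sub>R (b - a)) - \<tau> t)) \<longlonglongrightarrow> 0)"

definition edge_polys :: "nat \<Rightarrow> (real \<Rightarrow> real) set" where
  "edge_polys p = {f. \<exists>c. \<forall>t. f t = (\<Sum>i\<le>p. c i * t ^ i)}"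

definition outer_normal :: "(real^2) set \<Rightarrow> real^2 \<Rightarrow> real^2 \<Rightarrow> real^2 \<Rightarrow> bool" where
  "outer_normal T a b n \<longleftrightarrow> norm n = 1 \<and> n \<bullet> (b - a) = 0 \<and> (\<forall>x\<in>T. n \<bullet> (x - a) \<le> 0)"

text \<open>The equation \<open>\<Delta>\<^sup>2v + v = 0\<close> is meant in the sense of distributions.\<close>

definition U_loc :: "(real^2) set \<Rightarrow> (real^2 \<Rightarrow> real) set" where
  "U_loc T = {v \<in> H2 T.
     (\<forall>\<phi>. test_function T \<phi> \<longrightarrow> L2_inner T v (\<lambda>x. laplacian (laplacian \<phi>) x + \<phi> x) = 0) \<and>
     (\<forall>a b. closed_segment a b edge_of T \<longrightarrow>
        (\<exists>\<tau>\<in>edge_polys 3. has_edge_trace T a b v \<tau>)) \<and>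
     (\<forall>a b n. closed_segment a b edge_of T \<and> outer_normal T a b n \<longrightarrow>
        (\<exists>\<tau>\<in>edge_polys 1. has_edge_trace T a b (\<lambda>x. n \<bullet> weak_gradient T v x) \<tau>))}"

definition Uhat_loc :: "(real^2) set \<Rightarrow> trace_functional set" where
  "Uhat_loc T = tr_loc T ` U_loc T"

definition Uhat_h :: "(real^2) set \<Rightarrow> (real^2) set set \<Rightarrow> trace_functional set" where
  "Uhat_h \<Omega> \<T> = {\<uu> \<in> Uhat \<Omega> \<T>. \<forall>T\<in>\<T>. trace_restrict \<Omega> \<T> T \<uu> \<in> Uhat_loc T}"

type_synonym trial = "(real^2 \<Rightarrow> real) \<times> (real^2 \<Rightarrow> real^2^2) \<times> trace_functional"
type_synonym test = "(real^2 \<Rightarrow> real) \<times> (real^2 \<Rightarrow> real^2^2)"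

definition V_space :: "(real^2) set \<Rightarrow> (real^2) set set \<Rightarrow> test set" where
  "V_space \<Omega> \<T> = L2 \<Omega> \<times> Q_space \<T>"

definition V_norm :: "(real^2) set \<Rightarrow> (real^2) set set \<Rightarrow> test \<Rightarrow> real" where
  "V_norm \<Omega> \<T> = (\<lambda>(v, Q). sqrt ((L2_norm \<Omega> v)\<^sup>2 + (Q_norm \<T> Q)\<^sup>2))"

definition bform ::
  "(real^2) set \<Rightarrow> (real^2 \<Rightarrow> real^2^2) \<Rightarrow> (real^2) set set \<Rightarrow> trial \<Rightarrow> test \<Rightarrow> real" where
  "bform \<Omega> A \<T> = (\<lambda>(u, M, \<uu>) (v, Q).
     - broken_divDiv_inner \<T> u Q + L2_inner \<Omega> M (\<lambda>x. v x *\<^sub>R A x + Q x) + \<uu> Q)"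

definition U_h :: "(real^2) set \<Rightarrow> (real^2) set set \<Rightarrow> trial set" where
  "U_h \<Omega> \<T> = pw_polys 0 \<Omega> \<T> \<times> pw_polys_sym 0 \<Omega> \<T> \<times> Uhat_h \<Omega> \<T>"

definition Q_h :: "(real^2) set \<Rightarrow> (real^2) set set \<Rightarrow> (real^2 \<Rightarrow> real^2^2) set" where
  "Q_h \<Omega> \<T> = pw_polys_sym 4 \<Omega> \<T>"

definition V_hp :: "nat \<Rightarrow> (real^2) set \<Rightarrow> (real^2) set set \<Rightarrow> test set" where
  "V_hp p \<Omega> \<T> = pw_polys p \<Omega> \<T> \<times> Q_h \<Omega> \<T>"

definition Pi_L2 ::
  "nat \<Rightarrow> (real^2) set \<Rightarrow> (real^2) set set \<Rightarrow> (real^2 \<Rightarrow> real) \<Rightarrow> real^2 \<Rightarrow> real" where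
  "Pi_L2 p \<Omega> \<T> = L2_proj \<Omega> (pw_polys p \<Omega> \<T>)"

text \<open>
  The properties of the given operator on \<^const>\<open>Q_space\<close>, with stability constant \<open>C\<close>. As members
  of the spaces are functions modulo null sets, linearity is stated almost everywhere.
\<close>

definition divDiv_interpolation ::
  "(real^2) set \<Rightarrow> (real^2) set set \<Rightarrow> real \<Rightarrow>
   ((real^2 \<Rightarrow> real^2^2) \<Rightarrow> (real^2 \<Rightarrow> real^2^2)) \<Rightarrow> bool" where
  "divDiv_interpolation \<Omega> \<T> C P \<longleftrightarrow>
     (\<forall>Q\<in>Q_space \<T>. P Q \<in> Q_h \<Omega> \<T>) \<and>
     (\<forall>Q\<in>Q_space \<T>. \<forall>R\<in>Q_space \<T>. \<forall>\<alpha> \<beta>.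
        AE x in lebesgue_on \<Omega>. P (\<lambda>y. \<alpha> *\<^sub>R Q y + \<beta> *\<^sub>R R y) x = \<alpha> *\<^sub>R P Q x + \<beta> *\<^sub>R P R x) \<and>
     (\<forall>Q\<in>Q_space \<T>.
        (\<forall>\<uu>\<in>Uhat_h \<Omega> \<T>. \<uu> (P Q) = \<uu> Q) \<and>
        (\<forall>M\<in>pw_polys_sym 0 \<Omega> \<T>. L2_inner \<Omega> M (P Q) = L2_inner \<Omega> M Q) \<and>
        (\<forall>u\<in>pw_polys 2 \<Omega> \<T>. broken_divDiv_inner \<T> u (P Q) = broken_divDiv_inner \<T> u Q) \<and>
        Q_norm \<T> (P Q) \<le> C * Q_norm \<T> Q)"

definition Pi_F ::
  "nat \<Rightarrow> (real^2) set \<Rightarrow> (real^2) set set \<Rightarrow>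
   ((real^2 \<Rightarrow> real^2^2) \<Rightarrow> (real^2 \<Rightarrow> real^2^2)) \<Rightarrow> test \<Rightarrow> test" where
  "Pi_F p \<Omega> \<T> P = (\<lambda>(v, Q). (Pi_L2 p \<Omega> \<T> v, P Q))"

end

theory Submission
  imports Defs
begin

text \<open>
  The form \<open>b\<close> tests the two components of \<open>(v, Q)\<close> almost separately; the only coupling is through
  the term \<open>(M, A v + Q)\<close>, which splits as \<open>(v, M : A) + (M, Q)\<close>. For piecewise constant \<open>M\<close> and
  piecewise polynomial \<open>A\<close> of degree \<open>p\<close> the function \<open>M : A\<close> is again a piecewise polynomial of
  degree \<open>p\<close> (\<open>pw_polys_sym_inner\<close>), so replacing \<open>v\<close> by its orthogonal projection onto these
  polynomials leaves \<open>(v, M : A)\<close> unchanged. The three remaining terms involve \<open>Q\<close> only,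
  tested with traces in \<open>Uhat_h\<close>, with piecewise constant symmetric matrices and with piecewise
  constant functions, and these are moments that the given interpolation of \<open>Q\<close> preserves.

  Boundedness also holds componentwise: orthogonal projections do not increase the norm, and the
  interpolation is bounded with constant \<open>C\<close>. Hence \<open>max 1 C\<close> is a Fortin constant, uniformly in the mesh.

  The projection \<open>Pi_L2\<close> is defined through a choice operator, so the analytic core is that such a
  projection exists. In a space of functions modulo null sets this is done by a Gram-Schmidt
  induction (\<open>L2_orthogonal_approximation\<close>) on finitely many functions whose orthogonal complement
  is that of the whole subspace. For piecewise polynomials these functions are the monomials cut
  off to single triangles, and they determine everything because distinct triangles of a mesh
  overlap in null sets only (\<open>mesh_overlap_null\<close>).
\<close>

section \<open>Square-integrable functions\<close>

lemma L2_inner_integrable: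
  assumes "f \<in> L2 \<omega>" "g \<in> L2 \<omega>"
  shows "integrable (lebesgue_on \<omega>) (\<lambda>x. f x \<bullet> g x)"
proof (rule Bochner_Integration.integrable_bound)
  show "integrable (lebesgue_on \<omega>) (\<lambda>x. (norm (f x))\<^sup>2 + (norm (g x))\<^sup>2)"
    using assms by (auto simp: L2_def)
  show "(\<lambda>x. f x \<bullet> g x) \<in> borel_measurable (lebesgue_on \<omega>)"
    using assms by (auto simp: L2_def)
  have "norm (a \<bullet> b) \<le> (norm a)\<^sup>2 + (norm b)\<^sup>2" for a b :: 'b
  proof -
    have "\<bar>a \<bullet> b\<bar> \<le> norm a * norm b"
      by (rule Cauchy_Schwarz_ineq2)
    also have "\<dots> \<le> 2 * norm a * norm b" by simp
    also have "\<dots> \<le> (norm a)\<^sup>2 + (norm b)\<^sup>2"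
      by (rule sum_squares_bound)
    finally show ?thesis by simp
  qed
  then show "AE x in lebesgue_on \<omega>. norm (f x \<bullet> g x) \<le> norm ((norm (f x))\<^sup>2 + (norm (g x))\<^sup>2)"
    by simp
qed

lemma L2_add:
  assumes "f \<in> L2 \<omega>" "g \<in> L2 \<omega>"
  shows "(\<lambda>x. f x + g x) \<in> L2 \<omega>"
proof -
  have "(norm (f x + g x))\<^sup>2 = (norm (f x))\<^sup>2 + 2 * (f x \<bullet> g x) + (norm (g x))\<^sup>2" for x
    by (simp add: power2_norm_eq_inner inner_commute algebra_simps)
  then have "integrable (lebesgue_on \<omega>) (\<lambda>x. (norm (f x + g x))\<^sup>2)"
    using L2_inner_integrable[OF assms] assms
    by (auto simp: L2_def intro!: Bochner_Integration.integrable_add integrable_mult_right)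
  then show ?thesis
    using assms by (auto simp: L2_def intro!: borel_measurable_add)
qed

lemma L2_scaleR:
  assumes "f \<in> L2 \<omega>"
  shows "(\<lambda>x. c *\<^sub>R f x) \<in> L2 \<omega>"
  using assms by (auto simp: L2_def power_mult_distrib intro!: borel_measurable_scaleR integrable_mult_right)

lemma L2_diff:
  assumes "f \<in> L2 \<omega>" "g \<in> L2 \<omega>"
  shows "(\<lambda>x. f x - g x) \<in> L2 \<omega>"
  using L2_add[OF assms(1) L2_scaleR[OF assms(2), of "-1"]] by simp

lemma L2_mult:
  fixes f :: "'a::euclidean_space \<Rightarrow> real"
  assumes "f \<in> L2 \<omega>"
  shows "(\<lambda>x. c * f x) \<in> L2 \<omega>"
  using L2_scaleR[OF assms, of c] by simp

lemma L2_inner_commute: "L2_inner \<omega> f g = L2_inner \<omega> g f"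
  by (simp add: L2_inner_def inner_commute)

lemma L2_inner_add_right:
  assumes "f \<in> L2 \<omega>" "g \<in> L2 \<omega>" "h \<in> L2 \<omega>"
  shows "L2_inner \<omega> f (\<lambda>x. g x + h x) = L2_inner \<omega> f g + L2_inner \<omega> f h"
  using assms by (simp add: L2_inner_def inner_add_right L2_inner_integrable)

lemma L2_inner_diff_left:
  assumes "f \<in> L2 \<omega>" "g \<in> L2 \<omega>" "h \<in> L2 \<omega>"
  shows "L2_inner \<omega> (\<lambda>x. f x - g x) h = L2_inner \<omega> f h - L2_inner \<omega> g h"
  using assms by (simp add: L2_inner_def inner_diff_left L2_inner_integrable)

lemma L2_inner_mult_left:
  fixes f :: "'a::euclidean_space \<Rightarrow> real"
  shows "L2_inner \<omega> (\<lambda>x. c * f x) h = c * L2_inner \<omega> f h"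
  by (simp add: L2_inner_def mult.assoc)

lemma L2_inner_self_nonneg: "0 \<le> L2_inner \<omega> f f"
  by (simp add: L2_inner_def)

text \<open>
  The inner product is only semidefinite on functions. This is the degenerate case of the
  Gram-Schmidt step below, in which a new direction has norm zero and must be harmless.
\<close>

lemma L2_inner_eq_0:
  assumes "e \<in> L2 \<omega>" "L2_inner \<omega> e e = 0" "f \<in> L2 \<omega>"
  shows "L2_inner \<omega> f e = 0"
proof -
  have "AE x in lebesgue_on \<omega>. e x \<bullet> e x = 0"
    using integral_nonneg_eq_0_iff_AE[OF L2_inner_integrable[OF assms(1,1)]] assms(2)
    by (simp add: L2_inner_def)
  then have "AE x in lebesgue_on \<omega>. f x \<bullet> e x = 0"
    by eventually_elim simp
  then show ?thesis
    unfolding L2_inner_def by (rule integral_eq_zero_AE)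
qed

lemma L2_of_bounded:
  fixes f :: "'a::euclidean_space \<Rightarrow> 'b::euclidean_space"
  assumes "\<omega> \<in> lmeasurable" "f \<in> borel_measurable (lebesgue_on \<omega>)"
    and "AE x in lebesgue_on \<omega>. norm (f x) \<le> K"
  shows "f \<in> L2 \<omega>"
proof -
  interpret finite_measure "lebesgue_on \<omega>"
    using assms(1) by (rule finite_measure_lebesgue_on)
  have "integrable (lebesgue_on \<omega>) (\<lambda>x. (norm (f x))\<^sup>2)"
  proof (rule integrable_const_bound)
    show "AE x in lebesgue_on \<omega>. norm ((norm (f x))\<^sup>2) \<le> K\<^sup>2"
      using assms(3) by eventually_elim (simp add: power_mono)
    show "(\<lambda>x. (norm (f x))\<^sup>2) \<in> borel_measurable (lebesgue_on \<omega>)"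
      using assms(2) by measurable
  qed
  with assms(2) show ?thesis by (simp add: L2_def)
qed

lemma L2_of_cover:
  fixes f :: "'a::euclidean_space \<Rightarrow> 'b::euclidean_space"
  assumes "finite \<T>" "\<And>T. T \<in> \<T> \<Longrightarrow> T \<in> sets lebesgue" "\<omega> \<in> sets lebesgue" "\<omega> \<subseteq> \<Union>\<T>"
    and f: "\<And>T. T \<in> \<T> \<Longrightarrow> f \<in> L2 T"
  shows "f \<in> L2 \<omega>"
proof -
  have "f \<in> borel_measurable (lebesgue_on \<omega>)"
  proof (rule measurable_piecewise_restrict[of \<T>])
    show "countable \<T>"
      using assms(1) by (rule countable_finite)
    show "T \<inter> space (lebesgue_on \<omega>) \<in> sets (lebesgue_on \<omega>)" if "T \<in> \<T>" for T
      using assms(2)[OF that] assms(3) by (auto simp: sets_restrict_space)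
    show "space (lebesgue_on \<omega>) \<subseteq> \<Union>\<T>"
      using assms(4) by simp
    show "f \<in> borel_measurable (restrict_space (lebesgue_on \<omega>) T)" if "T \<in> \<T>" for T
    proof -
      have "f \<in> borel_measurable (restrict_space (lebesgue_on T) \<omega>)"
        using f[OF that] by (auto simp: L2_def intro: measurable_restrict_space1)
      then show ?thesis
        by (simp add: restrict_restrict_space assms(2,3) that Int_commute)
    qed
  qed
  moreover have "set_integrable lebesgue \<omega> (\<lambda>x. (norm (f x))\<^sup>2)"
  proof (rule set_integrable_subset)
    show "set_integrable lebesgue (\<Union>T\<in>\<T>. T) (\<lambda>x. (norm (f x))\<^sup>2)"
      using f assms(1,2)
      by (intro set_integrable_UN) (auto simp: L2_def set_integrable_def integrable_restrict_space)
  qed (use assms in auto)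
  ultimately show ?thesis
    using assms(3) by (simp add: L2_def set_integrable_def integrable_restrict_space)
qed

section \<open>Orthogonal projection onto finite-dimensional subspaces\<close>

definition L2_subspace :: "'a::euclidean_space set \<Rightarrow> ('a \<Rightarrow> real) set \<Rightarrow> bool" where
  "L2_subspace \<omega> S \<longleftrightarrow> S \<subseteq> L2 \<omega> \<and> (\<lambda>x. 0) \<in> S \<and>
     (\<forall>f\<in>S. \<forall>g\<in>S. (\<lambda>x. f x + g x) \<in> S) \<and> (\<forall>f\<in>S. \<forall>c. (\<lambda>x. c * f x) \<in> S)"

lemma L2_subspace_L2: "L2_subspace \<omega> S \<Longrightarrow> f \<in> S \<Longrightarrow> f \<in> L2 \<omega>"
  and L2_subspace_zero: "L2_subspace \<omega> S \<Longrightarrow> (\<lambda>x. 0) \<in> S"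
  and L2_subspace_add: "L2_subspace \<omega> S \<Longrightarrow> f \<in> S \<Longrightarrow> g \<in> S \<Longrightarrow> (\<lambda>x. f x + g x) \<in> S"
  and L2_subspace_mult: "L2_subspace \<omega> S \<Longrightarrow> f \<in> S \<Longrightarrow> (\<lambda>x. c * f x) \<in> S"
  by (auto simp: L2_subspace_def)

text \<open>
  This produces the projection \<open>w\<close> of \<open>v\<close> onto the span of \<open>B\<close>. That \<open>w\<close> lies in the span is
  expressed by duality, as \<open>w\<close> being orthogonal to whatever is orthogonal to \<open>B\<close>; this makes the
  induction free of linear combinations and insensitive to null sets. To add \<open>e\<close>, its projection
  \<open>u\<close> is subtracted and the residual of \<open>v\<close> is corrected by its component along \<open>d = e - u\<close>.
\<close>

lemma L2_orthogonal_approximation: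
  fixes S :: "('a::euclidean_space \<Rightarrow> real) set"
  assumes S: "L2_subspace \<omega> S" and "finite B" "B \<subseteq> S" "v \<in> L2 \<omega>"
  shows "\<exists>w\<in>S. (\<forall>b\<in>B. L2_inner \<omega> (\<lambda>x. v x - w x) b = 0) \<and>
    (\<forall>q\<in>L2 \<omega>. (\<forall>b\<in>B. L2_inner \<omega> q b = 0) \<longrightarrow> L2_inner \<omega> q w = 0)"
  using assms(2-)
proof (induction B arbitrary: v rule: finite_induct)
  case empty
  then show ?case
    using L2_subspace_zero[OF S] by (intro bexI[of _ "\<lambda>x. 0"]) (auto simp: L2_inner_def)
next
  case (insert e B)
  note L2I = L2_subspace_L2[OF S] and add = L2_subspace_add[OF S] and mult = L2_subspace_mult[OF S]
  have e: "e \<in> S" "e \<in> L2 \<omega>" and B: "\<And>b. b \<in> B \<Longrightarrow> b \<in> L2 \<omega>"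
    using insert.prems(1) L2I by auto
  obtain w where w: "w \<in> S" "\<And>b. b \<in> B \<Longrightarrow> L2_inner \<omega> (\<lambda>x. v x - w x) b = 0"
      "\<And>q. q \<in> L2 \<omega> \<Longrightarrow> \<forall>b\<in>B. L2_inner \<omega> q b = 0 \<Longrightarrow> L2_inner \<omega> q w = 0"
    using insert.IH[of v] insert.prems by auto
  obtain u where u: "u \<in> S" "\<And>b. b \<in> B \<Longrightarrow> L2_inner \<omega> (\<lambda>x. e x - u x) b = 0"
      "\<And>q. q \<in> L2 \<omega> \<Longrightarrow> \<forall>b\<in>B. L2_inner \<omega> q b = 0 \<Longrightarrow> L2_inner \<omega> q u = 0"
    using insert.IH[of e] insert.prems e by auto
  define d where "d = (\<lambda>x. e x - u x)"
  have d: "d \<in> S" "d \<in> L2 \<omega>"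
    using add[OF e(1) mult[OF u(1), of "-1"]] L2I by (auto simp: d_def)
  define r where "r = (\<lambda>x. v x - w x)"
  have r: "r \<in> L2 \<omega>"
    unfolding r_def by (intro L2_diff insert.prems L2I w(1))
  define c where "c = L2_inner \<omega> r d / L2_inner \<omega> d d"
  define z where "z = (\<lambda>x. w x + c * d x)"
  have z: "z \<in> S"
    unfolding z_def by (intro add mult w(1) d(1))
  have cd: "L2_inner \<omega> (\<lambda>x. c * d x) q = c * L2_inner \<omega> d q" for q
    by (rule L2_inner_mult_left)
  have diff: "L2_inner \<omega> (\<lambda>x. v x - z x) q = L2_inner \<omega> r q - c * L2_inner \<omega> d q"
    if "q \<in> L2 \<omega>" for q
  proof -
    have "(\<lambda>x. v x - z x) = (\<lambda>x. r x - c * d x)"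
      by (auto simp: z_def r_def)
    then show ?thesis
      using L2_inner_diff_left[OF r L2_mult[OF d(2), of c] that] by (simp add: cd)
  qed
  have vzB: "L2_inner \<omega> (\<lambda>x. v x - z x) b = 0" if "b \<in> B" for b
    using diff[OF B[OF that]] w(2)[OF that] u(2)[OF that] by (simp add: r_def d_def)
  have vz: "(\<lambda>x. v x - z x) \<in> L2 \<omega>"
    by (intro L2_diff insert.prems L2I z)
  \<comment> \<open>If \<open>d\<close> vanishes almost everywhere, then \<open>c = 0\<close> by division by zero, and orthogonality to \<open>d\<close> is trivial.\<close>
  have "L2_inner \<omega> (\<lambda>x. v x - z x) d = 0"
    using diff[OF d(2)] L2_inner_eq_0[OF d(2) _ r]
    by (cases "L2_inner \<omega> d d = 0") (auto simp: c_def)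
  moreover have "L2_inner \<omega> q e = L2_inner \<omega> q d"
    if "q \<in> L2 \<omega>" "\<forall>b\<in>B. L2_inner \<omega> q b = 0" for q
  proof -
    have "e = (\<lambda>x. d x + u x)" by (simp add: d_def)
    then show ?thesis
      using L2_inner_add_right[OF that(1) d(2) L2I[OF u(1)]] u(3)[OF that] by simp
  qed
  note qe = this
  ultimately have "L2_inner \<omega> (\<lambda>x. v x - z x) e = 0"
    using vz vzB by simp
  moreover have "L2_inner \<omega> q z = 0"
    if "q \<in> L2 \<omega>" "\<forall>b\<in>insert e B. L2_inner \<omega> q b = 0" for q
  proof -
    have "L2_inner \<omega> q d = 0" "L2_inner \<omega> q w = 0"
      using qe[of q] w(3)[of q] that by auto
    then show ?thesis
      using L2_inner_add_right[OF that(1) L2I[OF w(1)] L2_mult[OF d(2), of c]]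
      by (simp add: z_def L2_inner_commute[of \<omega> q] cd)
  qed
  ultimately show ?case
    using z vzB by (intro bexI[of _ z]) auto
qed

text \<open>
  A subspace may contain infinitely many functions that differ on null sets only, so it need not be
  the span of a finite set. It suffices that a finite set detects orthogonality to it.
\<close>

lemma L2_proj_orthogonal:
  fixes S :: "('a::euclidean_space \<Rightarrow> real) set"
  assumes S: "L2_subspace \<omega> S" and B: "finite B" "B \<subseteq> S"
    and detect: "\<forall>q\<in>L2 \<omega>. (\<forall>b\<in>B. L2_inner \<omega> q b = 0) \<longrightarrow> (\<forall>s\<in>S. L2_inner \<omega> q s = 0)"
    and v: "v \<in> L2 \<omega>"
  shows "L2_proj \<omega> S v \<in> S"
    and "q \<in> S \<Longrightarrow> L2_inner \<omega> (L2_proj \<omega> S v) q = L2_inner \<omega> v q"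
proof -
  obtain w where w: "w \<in> S" "\<forall>b\<in>B. L2_inner \<omega> (\<lambda>x. v x - w x) b = 0"
    using L2_orthogonal_approximation[OF S B v] by auto
  have "(\<lambda>x. v x - w x) \<in> L2 \<omega>"
    by (rule L2_diff[OF v L2_subspace_L2[OF S w(1)]])
  then have "\<forall>q\<in>S. L2_inner \<omega> (\<lambda>x. v x - w x) q = 0"
    using detect w(2) by blast
  then have *: "L2_proj \<omega> S v \<in> S \<and> (\<forall>q\<in>S. L2_inner \<omega> (\<lambda>x. v x - L2_proj \<omega> S v x) q = 0)"
    unfolding L2_proj_def
    using someI[of "\<lambda>w. w \<in> S \<and> (\<forall>q\<in>S. L2_inner \<omega> (\<lambda>x. v x - w x) q = 0)" w] w(1) by blast
  then show proj: "L2_proj \<omega> S v \<in> S" by blast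
  show "L2_inner \<omega> (L2_proj \<omega> S v) q = L2_inner \<omega> v q" if "q \<in> S"
    using L2_inner_diff_left[OF v L2_subspace_L2[OF S proj] L2_subspace_L2[OF S that]] * that
    by simp
qed

text \<open>
  Pythagoras: the orthogonality of \<open>w\<close> and \<open>v - w\<close> gives
  \<open>\<parallel>v - w\<parallel>\<^sup>2 = \<parallel>v\<parallel>\<^sup>2 - \<parallel>w\<parallel>\<^sup>2\<close>, and the left-hand side is nonnegative.
\<close>

lemma L2_norm_le_of_orthogonal:
  assumes v: "v \<in> L2 \<omega>" and w: "w \<in> L2 \<omega>" and eq: "L2_inner \<omega> w w = L2_inner \<omega> v w"
  shows "L2_norm \<omega> w \<le> L2_norm \<omega> v"
proof -
  have r: "(\<lambda>x. v x - w x) \<in> L2 \<omega>"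
    using v w by (rule L2_diff)
  have "L2_inner \<omega> (\<lambda>x. v x - w x) (\<lambda>x. v x - w x)
      = L2_inner \<omega> v (\<lambda>x. v x - w x) - L2_inner \<omega> w (\<lambda>x. v x - w x)"
    by (rule L2_inner_diff_left[OF v w r])
  also have "\<dots> = L2_inner \<omega> v v - L2_inner \<omega> w w"
    using L2_inner_diff_left[OF v w v] L2_inner_diff_left[OF v w w] eq
    by (simp add: L2_inner_commute[of \<omega> v "\<lambda>x. v x - w x"] L2_inner_commute[of \<omega> w "\<lambda>x. v x - w x"]
        L2_inner_commute[of \<omega> w v])
  finally show ?thesis
    using L2_inner_self_nonneg[of \<omega> "\<lambda>x. v x - w x"] by (simp add: L2_norm_def)
qed

section \<open>Polynomials on a mesh\<close>

lemma polys_add: "f \<in> polys p \<Longrightarrow> g \<in> polys p \<Longrightarrow> (\<lambda>x. f x + g x) \<in> polys p"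
proof -
  assume "f \<in> polys p" "g \<in> polys p"
  then obtain c d where
    "\<And>x. f x = (\<Sum>i\<le>p. \<Sum>j\<le>p - i. c i j * (x $ 1) ^ i * (x $ 2) ^ j)"
    "\<And>x. g x = (\<Sum>i\<le>p. \<Sum>j\<le>p - i. d i j * (x $ 1) ^ i * (x $ 2) ^ j)"
    by (auto simp: polys_def)
  then have "f x + g x = (\<Sum>i\<le>p. \<Sum>j\<le>p - i. (c i j + d i j) * (x $ 1) ^ i * (x $ 2) ^ j)" for x
    by (simp add: distrib_right sum.distrib)
  then show ?thesis
    unfolding polys_def by (intro CollectI exI[of _ "\<lambda>i j. c i j + d i j"]) simp
qed

lemma polys_mult: "f \<in> polys p \<Longrightarrow> (\<lambda>x. k * f x) \<in> polys p"
proof -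
  assume "f \<in> polys p"
  then obtain c where
    "\<And>x. f x = (\<Sum>i\<le>p. \<Sum>j\<le>p - i. c i j * (x $ 1) ^ i * (x $ 2) ^ j)"
    by (auto simp: polys_def)
  then have "k * f x = (\<Sum>i\<le>p. \<Sum>j\<le>p - i. (k * c i j) * (x $ 1) ^ i * (x $ 2) ^ j)" for x
    by (simp add: sum_distrib_left mult.assoc)
  then show ?thesis
    unfolding polys_def by (intro CollectI exI[of _ "\<lambda>i j. k * c i j"]) simp
qed

lemma polys_monomial:
  assumes "i \<le> p" "j \<le> p - i"
  shows "(\<lambda>x. (x $ 1) ^ i * (x $ 2) ^ j) \<in> polys p"
proof -
  have "(\<Sum>a\<le>p. \<Sum>b\<le>p - a. (if a = i \<and> b = j then 1 else 0) * (x $ 1) ^ a * (x $ 2) ^ b)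
      = (x $ 1) ^ i * (x $ 2) ^ j" for x :: "real^2"
  proof -
    have "(\<Sum>b\<le>p - a. (if a = i \<and> b = j then 1 else 0) * (x $ 1) ^ a * (x $ 2) ^ b)
        = (if a = i then (x $ 1) ^ i * (x $ 2) ^ j else 0)" for a
      using assms(2) by (simp add: if_distrib[of "\<lambda>c. c * _"] cong: if_cong)
    then show ?thesis
      using assms(1) by simp
  qed
  then show ?thesis
    unfolding polys_def by (intro CollectI exI[of _ "\<lambda>a b. if a = i \<and> b = j then 1 else 0"]) simp
qed

lemma polys_const: "(\<lambda>x. k) \<in> polys p"
  using polys_mult[OF polys_monomial[of 0 p 0], of k] by simp

lemma polys_0_const: "f \<in> polys 0 \<Longrightarrow> \<exists>k. f = (\<lambda>x. k)"
  by (auto simp: polys_def)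

lemma polys_continuous: "f \<in> polys p \<Longrightarrow> continuous_on S f"
proof -
  assume "f \<in> polys p"
  then obtain c where
    "f = (\<lambda>x. \<Sum>i\<le>p. \<Sum>j\<le>p - i. c i j * (x $ 1) ^ i * (x $ 2) ^ j)"
    by (auto simp: polys_def)
  then show ?thesis
    by (auto intro!: continuous_intros)
qed

context
  fixes \<Omega> :: "(real^2) set" and \<T> :: "(real^2) set set"
  assumes op: "open \<Omega>" and mesh: "mesh_of \<Omega> \<T>"
begin

lemma mesh_finite: "finite \<T>"
  using mesh by (simp add: mesh_of_def triangulation_def)

lemma mesh_covers: "\<Omega> \<subseteq> \<Union>\<T>"
  using mesh closure_subset[of \<Omega>] by (simp add: mesh_of_def)

lemma mesh_triangle: "T \<in> \<T> \<Longrightarrow> 2 simplex T"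
  using mesh by (simp add: mesh_of_def)

lemma triangle_measurable: "T \<in> \<T> \<Longrightarrow> T \<in> sets lebesgue"
  using compact_simplex[OF mesh_triangle] by (blast dest: lmeasurable_compact fmeasurableD)

lemma mesh_domain_lmeasurable: "\<Omega> \<in> lmeasurable"
proof -
  have "compact (\<Union>\<T>)"
    using mesh_finite compact_simplex[OF mesh_triangle] by (rule compact_Union)
  then have "bounded \<Omega>"
    using mesh_covers bounded_subset compact_imp_bounded by blast
  then show ?thesis
    using op by (rule lmeasurable_open)
qed

lemma mesh_domain_measurable: "\<Omega> \<in> sets lebesgue"
  using mesh_domain_lmeasurable by (rule fmeasurableD)

text \<open>
  Conformity makes the overlap a face of both triangles. Were it all of one of them, that triangle
  would be a proper face of the other, against equality of dimensions. So it is a proper face, hence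
  a convex set without interior, and such a set lies in its own frontier, which is negligible.
\<close>

lemma mesh_overlap_null:
  assumes "T \<in> \<T>" "T' \<in> \<T>" "T \<noteq> T'"
  shows "T \<inter> T' \<in> null_sets lebesgue"
proof -
  have face: "T \<inter> T' face_of T" "T \<inter> T' face_of T'"
    using mesh assms unfolding mesh_of_def triangulation_def by (blast, metis Int_commute)
  have dim: "aff_dim T = 2" "aff_dim T' = 2" and cvx: "convex T" "convex T'"
    using assms mesh_triangle aff_dim_simplex convex_simplex by blast+
  have "T \<inter> T' \<noteq> T"
  proof
    assume "T \<inter> T' = T"
    with face(2) have "aff_dim T < aff_dim T'"
      using face_of_aff_dim_lt[OF cvx(2)] assms(3) by metis
    with dim show False by simp
  qed
  with face(1) have "aff_dim (T \<inter> T') < 2"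
    using face_of_aff_dim_lt[OF cvx(1)] dim by metis
  then have "interior (T \<inter> T') = {}"
    using aff_dim_nonempty_interior[of "T \<inter> T'"] by fastforce
  then have "T \<inter> T' \<subseteq> frontier (T \<inter> T')"
    using closure_subset[of "T \<inter> T'"] by (simp add: frontier_def)
  then have "negligible (T \<inter> T')"
    using negligible_convex_frontier[of "T \<inter> T'"] cvx negligible_subset by (blast intro: convex_Int)
  then show ?thesis
    by (simp add: negligible_iff_null_sets)
qed

lemma mesh_AE_iff:
  assumes "T \<in> \<T>"
  shows "(AE x in lebesgue_on T. P x) \<longleftrightarrow> (AE x in lebesgue. x \<in> T \<longrightarrow> P x)"
  using triangle_measurable[OF assms] by (intro AE_restrict_space_iff) simp

lemma mesh_AE_all:
  assumes "\<And>T. T \<in> \<T> \<Longrightarrow> AE x in lebesgue_on T. P T x"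
  shows "AE x in lebesgue. \<forall>T\<in>\<T>. x \<in> T \<longrightarrow> P T x"
  using assms mesh_finite by (intro AE_finite_allI) (auto simp: mesh_AE_iff)

lemma mesh_AE_domain:
  assumes "AE x in lebesgue. P x"
  shows "AE x in lebesgue_on \<Omega>. x \<in> \<Omega> \<and> P x"
proof -
  have "\<Omega> \<inter> space lebesgue \<in> sets lebesgue"
    using mesh_domain_measurable by simp
  then have "(AE x in lebesgue_on \<Omega>. x \<in> \<Omega> \<and> P x) \<longleftrightarrow> (AE x in lebesgue. x \<in> \<Omega> \<longrightarrow> x \<in> \<Omega> \<and> P x)"
    by (rule AE_restrict_space_iff)
  then show ?thesis
    using assms by (auto elim: eventually_mono)
qed

lemma mesh_AE_unique:
  "AE x in lebesgue. \<forall>T\<in>\<T>. \<forall>T'\<in>\<T>. T \<noteq> T' \<longrightarrow> \<not> (x \<in> T \<and> x \<in> T')"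
proof -
  have "AE x in lebesgue. T \<noteq> T' \<longrightarrow> \<not> (x \<in> T \<and> x \<in> T')" if "T \<in> \<T>" "T' \<in> \<T>" for T T'
    using AE_not_in[OF mesh_overlap_null[OF that]] by (cases "T = T'") auto
  then show ?thesis
    using mesh_finite by (intro AE_finite_allI) auto
qed

lemma L2_of_triangles:
  fixes f :: "real^2 \<Rightarrow> 'b::euclidean_space"
  shows "(\<And>T. T \<in> \<T> \<Longrightarrow> f \<in> L2 T) \<Longrightarrow> f \<in> L2 \<Omega>"
  using mesh_finite triangle_measurable mesh_domain_measurable mesh_covers by (rule L2_of_cover)

text \<open>
  Square integrability is automatic: a polynomial is bounded on each of the finitely many compact
  triangles, and the domain has finite measure.
\<close>

lemma pw_polysI:
  assumes "f \<in> borel_measurable (lebesgue_on \<Omega>)"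
    and "\<And>T. T \<in> \<T> \<Longrightarrow> \<exists>q\<in>polys p. AE x in lebesgue_on T. f x = q x"
  shows "f \<in> pw_polys p \<Omega> \<T>"
proof -
  obtain q where q: "\<And>T. T \<in> \<T> \<Longrightarrow> q T \<in> polys p"
      "\<And>T. T \<in> \<T> \<Longrightarrow> AE x in lebesgue_on T. f x = q T x"
    using assms(2) by metis
  have "\<exists>K. \<forall>x\<in>T. \<bar>q T x\<bar> \<le> K" if "T \<in> \<T>" for T
  proof -
    have "compact (q T ` T)"
      using polys_continuous[OF q(1)[OF that]] compact_simplex[OF mesh_triangle[OF that]]
      by (rule compact_continuous_image)
    then show ?thesis
      using compact_imp_bounded by (fastforce simp: bounded_iff)
  qed
  then obtain K where K: "\<And>T x. T \<in> \<T> \<Longrightarrow> x \<in> T \<Longrightarrow> \<bar>q T x\<bar> \<le> K T"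
    by metis
  have "AE x in lebesgue_on \<Omega>. x \<in> \<Omega> \<and> (\<forall>T\<in>\<T>. x \<in> T \<longrightarrow> f x = q T x)"
    by (intro mesh_AE_domain mesh_AE_all q(2))
  then have "AE x in lebesgue_on \<Omega>. norm (f x) \<le> (\<Sum>T\<in>\<T>. \<bar>K T\<bar>)"
  proof eventually_elim
    case (elim x)
    then obtain T where T: "T \<in> \<T>" "x \<in> T"
      using mesh_covers by blast
    then have "norm (f x) \<le> \<bar>K T\<bar>"
      using elim K[OF T] by fastforce
    also have "\<dots> \<le> (\<Sum>T\<in>\<T>. \<bar>K T\<bar>)"
      using T(1) mesh_finite by (intro member_le_sum) auto
    finally show ?case .
  qed
  with assms(2) L2_of_bounded[OF mesh_domain_lmeasurable assms(1)] show ?thesis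
    by (auto simp: pw_polys_def)
qed

lemma pw_polys_measurable: "f \<in> pw_polys p \<Omega> \<T> \<Longrightarrow> f \<in> borel_measurable (lebesgue_on \<Omega>)"
  by (auto simp: pw_polys_def L2_def)

lemma pw_polys_L2: "f \<in> pw_polys p \<Omega> \<T> \<Longrightarrow> f \<in> L2 \<Omega>"
  by (simp add: pw_polys_def)

lemma pw_polys_obtain:
  assumes "f \<in> pw_polys p \<Omega> \<T>" "T \<in> \<T>"
  obtains q where "q \<in> polys p" "AE x in lebesgue_on T. f x = q x"
  using assms by (auto simp: pw_polys_def)

lemma pw_polys_add:
  assumes "f \<in> pw_polys p \<Omega> \<T>" "g \<in> pw_polys p \<Omega> \<T>"
  shows "(\<lambda>x. f x + g x) \<in> pw_polys p \<Omega> \<T>"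
proof (rule pw_polysI)
  show "(\<lambda>x. f x + g x) \<in> borel_measurable (lebesgue_on \<Omega>)"
    using assms by (intro borel_measurable_add pw_polys_measurable)
  fix T assume T: "T \<in> \<T>"
  obtain q where q: "q \<in> polys p" "AE x in lebesgue_on T. f x = q x"
    using pw_polys_obtain[OF assms(1) T] .
  obtain r where r: "r \<in> polys p" "AE x in lebesgue_on T. g x = r x"
    using pw_polys_obtain[OF assms(2) T] .
  have "AE x in lebesgue_on T. f x + g x = q x + r x"
    using q(2) r(2) by eventually_elim simp
  then show "\<exists>q\<in>polys p. AE x in lebesgue_on T. f x + g x = q x"
    using polys_add[OF q(1) r(1)] by (rule bexI)
qed

lemma pw_polys_times_pw_const:
  assumes "m \<in> pw_polys 0 \<Omega> \<T>" "f \<in> pw_polys p \<Omega> \<T>"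
  shows "(\<lambda>x. m x * f x) \<in> pw_polys p \<Omega> \<T>"
proof (rule pw_polysI)
  show "(\<lambda>x. m x * f x) \<in> borel_measurable (lebesgue_on \<Omega>)"
    using assms by (intro borel_measurable_times pw_polys_measurable)
  fix T assume T: "T \<in> \<T>"
  obtain r where r: "r \<in> polys 0" "AE x in lebesgue_on T. m x = r x"
    using pw_polys_obtain[OF assms(1) T] .
  obtain k where k: "r = (\<lambda>x. k)"
    using polys_0_const[OF r(1)] by blast
  obtain q where q: "q \<in> polys p" "AE x in lebesgue_on T. f x = q x"
    using pw_polys_obtain[OF assms(2) T] .
  have "AE x in lebesgue_on T. m x * f x = k * q x"
    using r(2) q(2) by eventually_elim (simp add: k)
  then show "\<exists>q\<in>polys p. AE x in lebesgue_on T. m x * f x = q x"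
    using polys_mult[OF q(1)] by (rule bexI)
qed

lemma pw_polys_const: "(\<lambda>x. k) \<in> pw_polys p \<Omega> \<T>"
  by (rule pw_polysI) (auto intro!: bexI[of _ "\<lambda>x. k"] polys_const)

lemma pw_polys_0_subset:
  assumes "f \<in> pw_polys 0 \<Omega> \<T>" shows "f \<in> pw_polys p \<Omega> \<T>"
  using pw_polys_times_pw_const[OF assms pw_polys_const[of 1 p]] by simp

lemma pw_polys_subspace: "L2_subspace \<Omega> (pw_polys p \<Omega> \<T>)"
  unfolding L2_subspace_def
  using pw_polys_L2 pw_polys_add pw_polys_times_pw_const[OF pw_polys_const] pw_polys_const
  by blast

text \<open>The reason why the degree of the coefficient \<open>A\<close> dictates the degree of the test functions.\<close>

lemma pw_polys_sym_inner:
  assumes "M \<in> pw_polys_sym 0 \<Omega> \<T>" "A \<in> pw_polys_sym p \<Omega> \<T>"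
  shows "(\<lambda>x. M x \<bullet> A x) \<in> pw_polys p \<Omega> \<T>"
proof -
  have "(\<lambda>x. M x $ i $ j * A x $ i $ j) \<in> pw_polys p \<Omega> \<T>" for i j
    using assms by (intro pw_polys_times_pw_const) (auto simp: pw_polys_sym_def)
  then have "(\<lambda>x. (M x $ 1 $ 1 * A x $ 1 $ 1 + M x $ 1 $ 2 * A x $ 1 $ 2) +
      (M x $ 2 $ 1 * A x $ 2 $ 1 + M x $ 2 $ 2 * A x $ 2 $ 2)) \<in> pw_polys p \<Omega> \<T>"
    by (intro pw_polys_add)
  then show ?thesis
    by (simp add: inner_vec_def sum_2)
qed

definition local_monomial :: "(real^2) set \<times> nat \<times> nat \<Rightarrow> real^2 \<Rightarrow> real" where
  "local_monomial = (\<lambda>(T, i, j) x. indicator T x * ((x $ 1) ^ i * (x $ 2) ^ j))"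

definition local_monomial_index :: "nat \<Rightarrow> ((real^2) set \<times> nat \<times> nat) set" where
  "local_monomial_index p = (SIGMA T:\<T>. SIGMA i:{..p}. {..p - i})"

lemma finite_local_monomial_index: "finite (local_monomial_index p)"
  using mesh_finite by (simp add: local_monomial_index_def)

lemma local_monomial_pw_polys:
  assumes "k \<in> local_monomial_index p"
  shows "local_monomial k \<in> pw_polys p \<Omega> \<T>"
proof -
  obtain T i j where k: "k = (T, i, j)" "T \<in> \<T>" "i \<le> p" "j \<le> p - i"
    using assms by (auto simp: local_monomial_index_def)
  let ?m = "\<lambda>x::real^2. (x $ 1) ^ i * (x $ 2) ^ j"
  have m: "?m \<in> polys p"
    using k by (intro polys_monomial)
  have b: "local_monomial k = (\<lambda>x. indicator T x * ?m x)"
    by (simp add: local_monomial_def k)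
  show ?thesis
    unfolding b
  proof (rule pw_polysI)
    show "(\<lambda>x. indicator T x * ?m x) \<in> borel_measurable (lebesgue_on \<Omega>)"
    proof (rule borel_measurable_times)
      show "(\<lambda>x. indicator T x) \<in> borel_measurable (lebesgue_on \<Omega>)"
        using triangle_measurable[OF k(2)]
        by (intro measurable_restrict_space1 borel_measurable_indicator)
      show "?m \<in> borel_measurable (lebesgue_on \<Omega>)"
        using polys_continuous[OF m] mesh_domain_measurable
        by (rule continuous_imp_measurable_on_sets_lebesgue)
    qed
    fix T' assume T': "T' \<in> \<T>"
    show "\<exists>q\<in>polys p. AE x in lebesgue_on T'. indicator T x * ?m x = q x"
    proof (cases "T' = T")
      case True
      have "AE x in lebesgue_on T'. indicator T x * ?m x = ?m x"
        unfolding mesh_AE_iff[OF T'] using True by auto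
      with m show ?thesis by (intro bexI[of _ ?m])
    next
      case False
      have "AE x in lebesgue_on T'. indicator T x * ?m x = 0"
        unfolding mesh_AE_iff[OF T'] using mesh_AE_unique
        by eventually_elim (use False T' k(2) in auto)
      then show ?thesis
        by (intro bexI[of _ "\<lambda>x. 0"] polys_const)
    qed
  qed
qed

text \<open>
  Almost every point lies in exactly one triangle, and there all cut-off monomials of the other
  triangles vanish. The expansion holds only up to null sets, as members of \<^const>\<open>pw_polys\<close> are
  arbitrary on null sets and the cut-offs add up on common edges.
\<close>

lemma pw_polys_expansion:
  assumes "s \<in> pw_polys p \<Omega> \<T>"
  shows "\<exists>c. AE x in lebesgue_on \<Omega>.
    s x = (\<Sum>k\<in>local_monomial_index p. c k * local_monomial k x)"
proof -
  have "\<forall>T\<in>\<T>. \<exists>c. AE x in lebesgue_on T.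
      s x = (\<Sum>i\<le>p. \<Sum>j\<le>p - i. c i j * (x $ 1) ^ i * (x $ 2) ^ j)"
  proof
    fix T assume T: "T \<in> \<T>"
    obtain q where q: "q \<in> polys p" "AE x in lebesgue_on T. s x = q x"
      using pw_polys_obtain[OF assms T] .
    then obtain c where "\<And>x. q x = (\<Sum>i\<le>p. \<Sum>j\<le>p - i. c i j * (x $ 1) ^ i * (x $ 2) ^ j)"
      by (auto simp: polys_def)
    with q(2) show "\<exists>c. AE x in lebesgue_on T.
        s x = (\<Sum>i\<le>p. \<Sum>j\<le>p - i. c i j * (x $ 1) ^ i * (x $ 2) ^ j)"
      by auto
  qed
  from bchoice[OF this] obtain c where c: "\<And>T. T \<in> \<T> \<Longrightarrow> AE x in lebesgue_on T.
      s x = (\<Sum>i\<le>p. \<Sum>j\<le>p - i. c T i j * (x $ 1) ^ i * (x $ 2) ^ j)"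
    by blast
  have c': "AE x in lebesgue_on \<Omega>. x \<in> \<Omega> \<and> (\<forall>T\<in>\<T>. x \<in> T \<longrightarrow>
      s x = (\<Sum>i\<le>p. \<Sum>j\<le>p - i. c T i j * (x $ 1) ^ i * (x $ 2) ^ j))"
    by (intro mesh_AE_domain mesh_AE_all c)
  have u: "AE x in lebesgue_on \<Omega>. x \<in> \<Omega> \<and>
      (\<forall>T\<in>\<T>. \<forall>T'\<in>\<T>. T \<noteq> T' \<longrightarrow> \<not> (x \<in> T \<and> x \<in> T'))"
    by (rule mesh_AE_domain) (rule mesh_AE_unique)
  have pointwise: "s x = (\<Sum>k\<in>local_monomial_index p. (case k of (T, i, j) \<Rightarrow> c T i j) * local_monomial k x)"
    if poly: "x \<in> \<Omega> \<and> (\<forall>T\<in>\<T>. x \<in> T \<longrightarrow>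
        s x = (\<Sum>i\<le>p. \<Sum>j\<le>p - i. c T i j * (x $ 1) ^ i * (x $ 2) ^ j))"
      and uniq: "x \<in> \<Omega> \<and> (\<forall>T\<in>\<T>. \<forall>T'\<in>\<T>. T \<noteq> T' \<longrightarrow> \<not> (x \<in> T \<and> x \<in> T'))" for x
  proof -
    obtain T where T: "T \<in> \<T>" "x \<in> T"
      using poly mesh_covers by blast
    let ?q = "\<lambda>T. \<Sum>i\<le>p. \<Sum>j\<le>p - i. c T i j * (x $ 1) ^ i * (x $ 2) ^ j"
    have "(\<Sum>k\<in>local_monomial_index p. (case k of (T, i, j) \<Rightarrow> c T i j) * local_monomial k x)
        = (\<Sum>T'\<in>\<T>. \<Sum>i\<le>p. \<Sum>j\<le>p - i.
            c T' i j * (indicator T' x * ((x $ 1) ^ i * (x $ 2) ^ j)))"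
      unfolding local_monomial_index_def local_monomial_def
      by (subst sum.Sigma, simp, simp, subst sum.Sigma, simp add: mesh_finite, simp)
        (simp only: split_def)
    also have "\<dots> = (\<Sum>T'\<in>\<T>. indicator T' x * ?q T')"
      by (simp only: sum_distrib_left mult_ac)
    also have "\<dots> = (\<Sum>T'\<in>\<T>. if T' = T then ?q T' else 0)"
      using uniq T by (intro sum.cong) auto
    also have "\<dots> = ?q T"
      using T(1) mesh_finite by simp
    also have "\<dots> = s x"
      using poly T by simp
    finally show ?thesis by simp
  qed
  have "AE x in lebesgue_on \<Omega>.
    s x = (\<Sum>k\<in>local_monomial_index p. (case k of (T, i, j) \<Rightarrow> c T i j) * local_monomial k x)"
    using eventually_conj[OF c' u] by (rule eventually_mono) (blast intro: pointwise)
  then show ?thesis by blast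
qed

lemma pw_polys_orthogonal_of_monomials:
  assumes q: "q \<in> L2 \<Omega>" and orth: "\<forall>b\<in>local_monomial ` local_monomial_index p. L2_inner \<Omega> q b = 0"
    and s: "s \<in> pw_polys p \<Omega> \<T>"
  shows "L2_inner \<Omega> q s = 0"
proof -
  let ?I = "local_monomial_index p"
  obtain c where c: "AE x in lebesgue_on \<Omega>. s x = (\<Sum>k\<in>?I. c k * local_monomial k x)"
    using pw_polys_expansion[OF s] by blast
  have L2: "local_monomial k \<in> L2 \<Omega>" if "k \<in> ?I" for k
    using local_monomial_pw_polys[OF that] by (simp add: pw_polys_def)
  have int: "integrable (lebesgue_on \<Omega>) (\<lambda>x. q x * local_monomial k x)" if "k \<in> ?I" for k
    using L2_inner_integrable[OF q L2[OF that]] by simp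
  have int': "integrable (lebesgue_on \<Omega>) (\<lambda>x. c k * (q x * local_monomial k x))" if "k \<in> ?I" for k
    using int[OF that] by simp
  have "L2_inner \<Omega> q s = (LINT x|lebesgue_on \<Omega>. (\<Sum>k\<in>?I. c k * (q x * local_monomial k x)))"
    unfolding L2_inner_def
  proof (rule integral_cong_AE)
    show "(\<lambda>x. q x \<bullet> s x) \<in> borel_measurable (lebesgue_on \<Omega>)"
      using q pw_polys_measurable[OF s] by (auto simp: L2_def)
    show "(\<lambda>x. \<Sum>k\<in>?I. c k * (q x * local_monomial k x)) \<in> borel_measurable (lebesgue_on \<Omega>)"
      using int' by (intro borel_measurable_sum borel_measurable_integrable)
    show "AE x in lebesgue_on \<Omega>. q x \<bullet> s x = (\<Sum>k\<in>?I. c k * (q x * local_monomial k x))"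
      using c by eventually_elim (simp add: sum_distrib_left mult_ac)
  qed
  also have "\<dots> = (\<Sum>k\<in>?I. c k * L2_inner \<Omega> q (local_monomial k))"
    using int' by (simp add: Bochner_Integration.integral_sum L2_inner_def)
  also have "\<dots> = 0"
    using orth by simp
  finally show ?thesis .
qed

text \<open>The choice in \<^const>\<open>L2_proj\<close> is thereby justified for piecewise polynomials.\<close>

lemma Pi_L2_pw_polys: "v \<in> L2 \<Omega> \<Longrightarrow> Pi_L2 p \<Omega> \<T> v \<in> pw_polys p \<Omega> \<T>"
  and Pi_L2_inner: "v \<in> L2 \<Omega> \<Longrightarrow> q \<in> pw_polys p \<Omega> \<T> \<Longrightarrow>
    L2_inner \<Omega> (Pi_L2 p \<Omega> \<T> v) q = L2_inner \<Omega> v q"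
proof -
  have B: "finite (local_monomial ` local_monomial_index p)"
      "local_monomial ` local_monomial_index p \<subseteq> pw_polys p \<Omega> \<T>"
    using finite_local_monomial_index local_monomial_pw_polys by auto
  have orth: "\<forall>q\<in>L2 \<Omega>. (\<forall>b\<in>local_monomial ` local_monomial_index p. L2_inner \<Omega> q b = 0) \<longrightarrow>
      (\<forall>s\<in>pw_polys p \<Omega> \<T>. L2_inner \<Omega> q s = 0)"
    by (intro ballI impI) (rule pw_polys_orthogonal_of_monomials)
  show "Pi_L2 p \<Omega> \<T> v \<in> pw_polys p \<Omega> \<T>" if "v \<in> L2 \<Omega>"
    using L2_proj_orthogonal(1)[OF pw_polys_subspace[of p] B orth that] by (simp add: Pi_L2_def)
  show "L2_inner \<Omega> (Pi_L2 p \<Omega> \<T> v) q = L2_inner \<Omega> v q"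
    if "v \<in> L2 \<Omega>" "q \<in> pw_polys p \<Omega> \<T>"
    using L2_proj_orthogonal(2)[OF pw_polys_subspace[of p] B orth that] by (simp add: Pi_L2_def)
qed

lemma Pi_L2_norm_le:
  assumes "v \<in> L2 \<Omega>"
  shows "L2_norm \<Omega> (Pi_L2 p \<Omega> \<T> v) \<le> L2_norm \<Omega> v"
proof -
  note S = Pi_L2_pw_polys[OF assms, of p]
  show ?thesis
    by (rule L2_norm_le_of_orthogonal[OF assms L2_subspace_L2[OF pw_polys_subspace S]
          Pi_L2_inner[OF assms S]])
qed

lemma Q_space_L2: "Q \<in> Q_space \<T> \<Longrightarrow> Q \<in> L2 \<Omega>"
proof (rule L2_of_triangles)
  fix T assume "Q \<in> Q_space \<T>" "T \<in> \<T>"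
  then obtain g where "has_divDiv T Q g"
    by (auto simp: Q_space_def H_divDiv_def)
  then show "Q \<in> L2 T"
    unfolding has_divDiv_def L2_sym_def by blast
qed

text \<open>
  Separating the two integrals needs integrability of \<open>v (M : A)\<close>, which holds since
  \<open>M : A\<close> is square integrable as a piecewise polynomial.
\<close>

lemma L2_inner_coefficient_split:
  assumes M: "M \<in> pw_polys_sym 0 \<Omega> \<T>" and A: "A \<in> pw_polys_sym p \<Omega> \<T>"
    and v: "v \<in> L2 \<Omega>" and Q: "Q \<in> L2 \<Omega>"
  shows "L2_inner \<Omega> M (\<lambda>x. v x *\<^sub>R A x + Q x)
    = L2_inner \<Omega> v (\<lambda>x. M x \<bullet> A x) + L2_inner \<Omega> M Q"
proof -
  have "(\<lambda>x. M x \<bullet> A x) \<in> L2 \<Omega>"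
    using pw_polys_sym_inner[OF M A] by (simp add: pw_polys_def)
  then have 1: "integrable (lebesgue_on \<Omega>) (\<lambda>x. v x * (M x \<bullet> A x))"
    using L2_inner_integrable[OF v] by simp
  have "M \<in> L2 \<Omega>"
    using M by (simp add: pw_polys_sym_def L2_sym_def)
  then have 2: "integrable (lebesgue_on \<Omega>) (\<lambda>x. M x \<bullet> Q x)"
    using Q by (rule L2_inner_integrable)
  show ?thesis
    using 1 2 by (simp add: L2_inner_def inner_add_right)
qed

end

section \<open>The Fortin property\<close>

lemma Q_norm_nonneg: "0 \<le> Q_norm \<T> Q"
  by (simp add: Q_norm_def sum_nonneg)

theorem theorem23:
  fixes \<Omega> :: "(real^2) set" and A :: "real^2 \<Rightarrow> real^2^2" and \<kappa> C :: real
  assumes "convex_polygonal_domain \<Omega>"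
    and "elliptic_coefficient \<Omega> A"
  shows "\<exists>C_F>0. \<forall>\<T> p P.
    mesh_of \<Omega> \<T> \<and> shape_regular \<kappa> \<T> \<and> divDiv_interpolation \<Omega> \<T> C P \<and>
    A \<in> pw_polys_sym p \<Omega> \<T> \<longrightarrow>
      (\<forall>v\<in>V_space \<Omega> \<T>. Pi_F p \<Omega> \<T> P v \<in> V_hp p \<Omega> \<T>) \<and>
      (\<forall>v\<in>V_space \<Omega> \<T>. V_norm \<Omega> \<T> (Pi_F p \<Omega> \<T> P v) \<le> C_F * V_norm \<Omega> \<T> v) \<and>
      (\<forall>u\<in>U_h \<Omega> \<T>. \<forall>v\<in>V_space \<Omega> \<T>.
         bform \<Omega> A \<T> u (Pi_F p \<Omega> \<T> P v) = bform \<Omega> A \<T> u v)"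
  \<comment> \<open>The maximum also yields a positive constant, whatever the sign of \<open>C\<close>.\<close>
proof (intro exI[of _ "max 1 C"] conjI allI impI ballI)
  show "0 < max 1 C" by simp
next
  fix \<T> p P v
  assume hyp: "mesh_of \<Omega> \<T> \<and> shape_regular \<kappa> \<T> \<and> divDiv_interpolation \<Omega> \<T> C P \<and>
    A \<in> pw_polys_sym p \<Omega> \<T>" and v: "v \<in> V_space \<Omega> \<T>"
  have op: "open \<Omega>"
    using assms(1) by (simp add: convex_polygonal_domain_def)
  have mesh: "mesh_of \<Omega> \<T>" and A: "A \<in> pw_polys_sym p \<Omega> \<T>"
    using hyp by auto
  obtain w Q where vwQ: "v = (w, Q)" and w: "w \<in> L2 \<Omega>" and Q: "Q \<in> Q_space \<T>"
    using v by (auto simp: V_space_def)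
  have P: "P Q \<in> Q_h \<Omega> \<T>" "\<And>\<uu>. \<uu> \<in> Uhat_h \<Omega> \<T> \<Longrightarrow> \<uu> (P Q) = \<uu> Q"
      "\<And>M. M \<in> pw_polys_sym 0 \<Omega> \<T> \<Longrightarrow> L2_inner \<Omega> M (P Q) = L2_inner \<Omega> M Q"
      "\<And>u. u \<in> pw_polys 2 \<Omega> \<T> \<Longrightarrow>
         broken_divDiv_inner \<T> u (P Q) = broken_divDiv_inner \<T> u Q"
      "Q_norm \<T> (P Q) \<le> C * Q_norm \<T> Q"
    using hyp Q unfolding divDiv_interpolation_def by blast+
  show "Pi_F p \<Omega> \<T> P v \<in> V_hp p \<Omega> \<T>"
    using Pi_L2_pw_polys[OF op mesh w, of p] P(1) by (simp add: vwQ Pi_F_def V_hp_def)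
  show "V_norm \<Omega> \<T> (Pi_F p \<Omega> \<T> P v) \<le> max 1 C * V_norm \<Omega> \<T> v"
  proof -
    let ?K = "max 1 C"
    have "L2_norm \<Omega> (Pi_L2 p \<Omega> \<T> w) \<le> 1 * L2_norm \<Omega> w"
      using Pi_L2_norm_le[OF op mesh w] by simp
    also have "\<dots> \<le> ?K * L2_norm \<Omega> w"
      by (intro mult_right_mono) (auto simp: L2_norm_def L2_inner_self_nonneg)
    finally have 1: "(L2_norm \<Omega> (Pi_L2 p \<Omega> \<T> w))\<^sup>2 \<le> (?K * L2_norm \<Omega> w)\<^sup>2"
      by (intro power_mono) (auto simp: L2_norm_def L2_inner_self_nonneg)
    have "Q_norm \<T> (P Q) \<le> ?K * Q_norm \<T> Q"
      using P(5) by (rule order_trans) (intro mult_right_mono Q_norm_nonneg, simp)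
    then have 2: "(Q_norm \<T> (P Q))\<^sup>2 \<le> (?K * Q_norm \<T> Q)\<^sup>2"
      by (intro power_mono Q_norm_nonneg)
    have "(L2_norm \<Omega> (Pi_L2 p \<Omega> \<T> w))\<^sup>2 + (Q_norm \<T> (P Q))\<^sup>2
        \<le> ?K\<^sup>2 * ((L2_norm \<Omega> w)\<^sup>2 + (Q_norm \<T> Q)\<^sup>2)"
      using 1 2 by (simp only: power_mult_distrib distrib_left)
    then have "sqrt ((L2_norm \<Omega> (Pi_L2 p \<Omega> \<T> w))\<^sup>2 + (Q_norm \<T> (P Q))\<^sup>2)
        \<le> sqrt (?K\<^sup>2 * ((L2_norm \<Omega> w)\<^sup>2 + (Q_norm \<T> Q)\<^sup>2))"
      by (rule real_sqrt_le_mono)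
    then show ?thesis
      by (simp add: vwQ Pi_F_def V_norm_def real_sqrt_mult)
  qed
  fix u
  assume u: "u \<in> U_h \<Omega> \<T>"
  obtain u0 M \<uu> where uMu: "u = (u0, M, \<uu>)" and u0: "u0 \<in> pw_polys 0 \<Omega> \<T>"
      and M: "M \<in> pw_polys_sym 0 \<Omega> \<T>" and \<uu>: "\<uu> \<in> Uhat_h \<Omega> \<T>"
    using u by (auto simp: U_h_def)
  note S = Pi_L2_pw_polys[OF op mesh w, of p]
  have PQ: "P Q \<in> L2 \<Omega>"
    using P(1) by (simp add: Q_h_def pw_polys_sym_def L2_sym_def)
  have "L2_inner \<Omega> M (\<lambda>x. Pi_L2 p \<Omega> \<T> w x *\<^sub>R A x + P Q x)
      = L2_inner \<Omega> M (\<lambda>x. w x *\<^sub>R A x + Q x)"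
    using L2_inner_coefficient_split[OF op mesh M A w Q_space_L2[OF op mesh Q]]
      L2_inner_coefficient_split[OF op mesh M A L2_subspace_L2[OF pw_polys_subspace[OF op mesh] S] PQ]
      Pi_L2_inner[OF op mesh w pw_polys_sym_inner[OF op mesh M A]] P(3)[OF M]
    by simp
  then show "bform \<Omega> A \<T> u (Pi_F p \<Omega> \<T> P v) = bform \<Omega> A \<T> u v"
    using P(2)[OF \<uu>] P(4)[OF pw_polys_0_subset[OF op mesh u0]]
    by (simp add: uMu vwQ bform_def Pi_F_def)
qed

end
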